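(* Let $P$ be a closed $2n$-gon formed by a pair $(S^-,S)$ of closed $n$-gons in $\mathbb{P}^1$. The infinitesimal monodromy for the leapfrog map (with respect to the scaling symmetry $o_i^-(t)=t\,o_i^-$, $o_i(t)=o_i$) is $$M'(1)=\sum_{i=1}^n \frac{1}{s_i^--s_{i}}\begin{pmatrix} s_i^- & -s_i^-s_{i}\\ 1 & -s_{i}\end{pmatrix}$$ (as an element of $\mathfrak{pgl}_2$), and its eigenvectors $(X,Y)^T$ are roots of the polynomial $$\chi_P(X,Y)=\sum_{i=1}^n \frac{(X-s_i^-Y)(X-s_{i}Y)}{s_i^--s_{i}}.$$
   Context: Let $F$ be a field, $\mathbb{P}^1=\mathbb{P}^1(F)$, $\mathrm{PGL}_2=\mathrm{GL}_2(F)/F^*$, $\mathbb{G}_m=F^*$ (as algebraic group). For four points of $\mathbb{P}^1$, $[a,b,c,d]=\frac{a-c}{a-d}\cdot\frac{b-d}{b-c}$. A (twisted) $m$-gon in $\mathbb{P}^1$ is $((p_i)_{i\in\mathbb{Z}},M)$ with monodromy $M\in\mathrm{PGL}_2$, $p_{i+m}=Mp_i$, with $p_i,p_{i+1},p_{i+2}$ pairwise distinct for all $i$; it is closed if $M=\mathrm{Id}$. $\mathrm{PGL}_2$ acts by $A\cdot((p_i),M)=((Ap_i),AMA^{-1})$, with quotient the moduli space $\mathcal T_m$. Points are identified with affine coordinates in $F$. Leapfrog map: take two $n$-gons $S^-=(s_i^-)$, $S=(s_i)$ with the same monodromy, intertwined as $\dots,s_i^-,s_i,s_{i+1}^-,s_{i+1},\dots$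 to form a $2n$-gon $P$ (same monodromy). The map is $\Phi:(S^-,S)\mapsto(S,S^+)$, where $s_i^+$ is the image of $s_i^-$ under the unique projective transformation fixing $s_i$ and interchanging $s_{i-1}$ with $s_{i+1}$. The coordinates on the moduli space are $o_i^-=[s_i^-,s_i,s_{i-1},s_{i+1}^-]$ and $o_i=[s_i,s_{i+1}^-,s_i^-,s_{i+1}]$. The action $\rho$ of $\mathbb{G}_m$ given by $o_i^-(t)=t\,o_i^-$, $o_i(t)=o_i$ is a scaling symmetry, i.e. a non-trivial action on the moduli space commuting with the dynamic; write $[P]_t$ for the deformed class. A lift of the deformation is an algebraic family $(P_t)$ of polygons with $P_1=P$, $[P_t]=[P]_t$; $M(t)$ denotes the monodromy of $P_t$. For $P$ closed, the infinitesimal monodromy is $M'(1)\in\mathfrak{pgl}_2=\mathfrak{gl}_2/F\cdot\mathrm{Id}$ (the tangent vector at $M(1)=\mathrm{Id}$), independent of the lift. *)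

theory Defs
  imports
    "HOL-Analysis.Determinants"
    "HOL-Computational_Algebra.Polynomial_Factorial"
begin

section \<open>The projective line and its symmetries\<close>

definition wedge :: "'a::field ^ 2 \<Rightarrow> 'a ^ 2 \<Rightarrow> 'a" where
  "wedge v w = v $ 1 * w $ 2 - v $ 2 * w $ 1"

quotient_type (overloaded) 'a proj_line = "('a::field) ^ 2" / partial:
  "\<lambda>v w. v \<noteq> 0 \<and> w \<noteq> 0 \<and> (\<exists>c. c \<noteq> 0 \<and> w = c *s v)"
  morphisms rep_point point
proof (rule part_equivpI)
  show "\<exists>v. (v::'a^2) \<noteq> 0 \<and> v \<noteq> 0 \<and> (\<exists>c. c \<noteq> 0 \<and> v = c *s v)"
    by (intro exI[of _ "vec 1"]) (auto simp: vec_eq_iff intro!: exI[of _ 1])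
  show "symp (\<lambda>v w. (v::'a^2) \<noteq> 0 \<and> w \<noteq> 0 \<and> (\<exists>c. c \<noteq> 0 \<and> w = c *s v))"
  proof (rule sympI, elim conjE exE)
    fix v w :: "'a^2" and c
    assume "v \<noteq> 0" "w \<noteq> 0" "c \<noteq> 0" "w = c *s v"
    then show "w \<noteq> 0 \<and> v \<noteq> 0 \<and> (\<exists>c. c \<noteq> 0 \<and> v = c *s w)"
      by (intro conjI exI[of _ "inverse c"]) (auto simp: vector_smult_assoc)
  qed
  show "transp (\<lambda>v w. (v::'a^2) \<noteq> 0 \<and> w \<noteq> 0 \<and> (\<exists>c. c \<noteq> 0 \<and> w = c *s v))"
  proof (rule transpI, elim conjE exE)
    fix u v w :: "'a^2" and c d
    assume "u \<noteq> 0" "w \<noteq> 0" "c \<noteq> 0" "d \<noteq> 0" "v = c *s u" "w = d *s v"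
    then show "u \<noteq> 0 \<and> w \<noteq> 0 \<and> (\<exists>c. c \<noteq> 0 \<and> w = c *s u)"
      by (intro conjI exI[of _ "d * c"]) (auto simp: vector_smult_assoc)
  qed
qed

definition affine_point :: "'a::field \<Rightarrow> 'a proj_line" where
  "affine_point a = point (vector [a, 1])"

text \<open>
  Homogeneous form of \<open>(a - c) / (a - d) * ((b - d) / (b - c))\<close>, which it is for affine points.
  It has its intended value only if \<open>a \<noteq> d\<close> and \<open>b \<noteq> c\<close>; in the coordinates below these pairs
  of vertices are at distance at most two in the polygon, hence distinct.
\<close>

lift_definition cross_ratio ::
  "'a::field proj_line \<Rightarrow> 'a proj_line \<Rightarrow> 'a proj_line \<Rightarrow> 'a proj_line \<Rightarrow> 'a"
  is "\<lambda>a b c d. wedge a c / wedge a d * (wedge b d / wedge b c)"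
  by (auto simp: wedge_def mult.assoc mult.left_commute
      simp flip: right_diff_distrib)

quotient_type (overloaded) 'a PGL2 = "('a::field) ^ 2 ^ 2" / partial:
  "\<lambda>A B. invertible A \<and> invertible B \<and> (\<exists>c. c \<noteq> 0 \<and> B = map_matrix ((*) c) A)"
  morphisms rep_PGL2 PGL2
proof (rule part_equivpI)
  let ?R = "\<lambda>A B. invertible (A::'a^2^2) \<and> invertible B \<and>
    (\<exists>c. c \<noteq> 0 \<and> B = map_matrix ((*) c) A)"
  show "\<exists>A. ?R A A"
    by (intro exI[of _ "mat 1"]) (auto simp: vec_eq_iff invertible_det_nz intro!: exI[of _ 1])
  show "symp ?R"
  proof (rule sympI, elim conjE exE)
    fix A B :: "'a^2^2" and c
    assume "invertible A" "invertible B" "c \<noteq> 0" "B = map_matrix ((*) c) A"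
    then show "?R B A"
      by (intro conjI exI[of _ "inverse c"]) (assumption | simp add: vec_eq_iff)+
  qed
  show "transp ?R"
  proof (rule transpI, elim conjE exE)
    fix A B C :: "'a^2^2" and c d
    assume "invertible A" "invertible C" "c \<noteq> 0" "d \<noteq> 0"
      "B = map_matrix ((*) c) A" "C = map_matrix ((*) d) B"
    then show "?R A C"
      by (intro conjI exI[of _ "d * c"]) (assumption | simp add: vec_eq_iff)+
  qed
qed

lift_definition PGL2_id :: "'a::field PGL2" is "mat 1"
  by (auto simp: vec_eq_iff invertible_det_nz intro!: exI[of _ 1])

lift_definition PGL2_act :: "'a::field PGL2 \<Rightarrow> 'a proj_line \<Rightarrow> 'a proj_line" is "(*v)"
proof (elim conjE exE)
  fix A B :: "'a^2^2" and v w :: "'a^2" and c d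
  assume A: "invertible A" and B: "invertible B"
    and v: "v \<noteq> 0" and w: "w \<noteq> 0" and cd: "c \<noteq> 0" "d \<noteq> 0"
    and eq: "B = map_matrix ((*) c) A" "w = d *s v"
  have "A *v v \<noteq> 0" "B *v w \<noteq> 0"
    using A B v w by (metis invertible_def matrix_left_invertible_ker)+
  moreover have "B *v w = (c * d) *s (A *v v)"
    by (simp add: eq vec_eq_iff matrix_vector_mult_def sum_distrib_left mult_ac)
  ultimately show "A *v v \<noteq> 0 \<and> B *v w \<noteq> 0 \<and> (\<exists>e. e \<noteq> 0 \<and> B *v w = e *s (A *v v))"
    using cd by (intro conjI exI[of _ "c * d"]) auto
qed

quotient_type (overloaded) 'a pgl2 = "('a::field) ^ 2 ^ 2" / "\<lambda>A B. \<exists>c. B = A + mat c"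
  morphisms rep_pgl2 pgl2
proof (rule equivpI)
  show "reflp (\<lambda>A B. \<exists>c. (B::'a^2^2) = A + mat c)"
    by (rule reflpI, rule exI[of _ 0]) (simp add: vec_eq_iff mat_def)
  show "symp (\<lambda>A B. \<exists>c. (B::'a^2^2) = A + mat c)"
  proof (rule sympI, elim exE)
    fix A B :: "'a^2^2" and c assume "B = A + mat c"
    then show "\<exists>c. A = B + mat c"
      by (intro exI[of _ "- c"]) (simp add: vec_eq_iff mat_def)
  qed
  show "transp (\<lambda>A B. \<exists>c. (B::'a^2^2) = A + mat c)"
  proof (rule transpI, elim exE)
    fix A B C :: "'a^2^2" and c d assume "B = A + mat c" "C = B + mat d"
    then show "\<exists>c. C = A + mat c"
      by (intro exI[of _ "c + d"]) (simp add: vec_eq_iff mat_def)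
  qed
qed

lemma matrix_vector_mult_mat: "mat c *v v = c *s (v :: 'a::field ^ 2)"
  by (simp add: vec_eq_iff matrix_vector_mult_def mat_def if_distrib[of "\<lambda>x. x * _"] cong: if_cong)

text \<open>Adding a scalar matrix does not change the eigenvectors, only the eigenvalues.\<close>

lift_definition pgl2_eigenvector :: "'a::field pgl2 \<Rightarrow> 'a ^ 2 \<Rightarrow> bool"
  is "\<lambda>A v. v \<noteq> 0 \<and> (\<exists>l. A *v v = l *s v)"
proof (elim exE)
  fix A B :: "'a^2^2" and c assume "B = A + mat c"
  then have "B *v v = A *v v + c *s v" for v
    by (simp add: matrix_vector_mult_add_rdistrib matrix_vector_mult_mat)
  then have "(\<exists>l. A *v v = l *s v) \<longleftrightarrow> (\<exists>l. B *v v = l *s v)" for v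
    by (metis add_diff_cancel_right' vector_sadd_rdistrib vector_ssub_ldistrib vector_sub_rdistrib)
  then show "(\<lambda>v. v \<noteq> 0 \<and> (\<exists>l. A *v v = l *s v)) = (\<lambda>v. v \<noteq> 0 \<and> (\<exists>l. B *v v = l *s v))"
    by auto
qed


section \<open>Twisted polygons\<close>

definition twisted_polygon :: "nat \<Rightarrow> (int \<Rightarrow> 'a::field proj_line) \<Rightarrow> 'a PGL2 \<Rightarrow> bool" where
  "twisted_polygon m p M \<longleftrightarrow> 0 < m \<and>
     (\<forall>i. p (i + int m) = PGL2_act M (p i)) \<and>
     (\<forall>i. p i \<noteq> p (i + 1) \<and> p (i + 1) \<noteq> p (i + 2) \<and> p i \<noteq> p (i + 2))"

definition closed_polygon :: "nat \<Rightarrow> (int \<Rightarrow> 'a::field proj_line) \<Rightarrow> bool" where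
  "closed_polygon m p \<longleftrightarrow> twisted_polygon m p PGL2_id"

text \<open>The vertex sequence \<open>\<dots>, s\<^sup>-\<^sub>i, s\<^sub>i, s\<^sup>-\<^sub>i\<^sub>+\<^sub>1, s\<^sub>i\<^sub>+\<^sub>1, \<dots>\<close>,
  numbered so that \<open>s\<^sup>-\<^sub>i\<close> has index \<open>2 i\<close> and \<open>s\<^sub>i\<close> has index \<open>2 i + 1\<close>.\<close>

definition intertwine :: "(int \<Rightarrow> 'p) \<Rightarrow> (int \<Rightarrow> 'p) \<Rightarrow> int \<Rightarrow> 'p" where
  "intertwine sm s k = (if even k then sm (k div 2) else s (k div 2))"

definition o_minus :: "(int \<Rightarrow> 'a::field proj_line) \<Rightarrow> (int \<Rightarrow> 'a proj_line) \<Rightarrow> int \<Rightarrow> 'a" where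
  "o_minus sm s i = cross_ratio (sm i) (s i) (s (i - 1)) (sm (i + 1))"

definition o_plain :: "(int \<Rightarrow> 'a::field proj_line) \<Rightarrow> (int \<Rightarrow> 'a proj_line) \<Rightarrow> int \<Rightarrow> 'a" where
  "o_plain sm s i = cross_ratio (s i) (sm (i + 1)) (sm i) (s (i + 1))"


section \<open>Algebraic families and infinitesimal monodromy\<close>

text \<open>
  An algebraic family of points of the projective line, parametrised by a neighbourhood of
  \<open>t = 1\<close> in the multiplicative group, is given by a vector \<open>v\<close> of homogeneous coordinates in
  \<open>F[t]\<close> with \<open>v(1) \<noteq> 0\<close>. An algebraic family in \<open>PGL\<^sub>2\<close> is likewise given by a matrix \<open>A\<close>
  over \<open>F[t]\<close> with \<open>A(1)\<close> invertible. Identities that hold for all \<open>t\<close> are stated over the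
  field \<open>F(t)\<close>, since \<open>F\<close> may be finite.
\<close>

definition poly_vec_at :: "'a::field \<Rightarrow> 'a poly ^ 2 \<Rightarrow> 'a ^ 2" where
  "poly_vec_at t v = (\<chi> i. poly (v $ i) t)"

definition poly_mat_at :: "'a::field \<Rightarrow> 'a poly ^ 2 ^ 2 \<Rightarrow> 'a ^ 2 ^ 2" where
  "poly_mat_at t A = map_matrix (\<lambda>f. poly f t) A"

definition generic_point :: "'a::field poly ^ 2 \<Rightarrow> 'a poly fract proj_line" where
  "generic_point v = point (\<chi> i. to_fract (v $ i))"

definition generic_PGL2 :: "'a::field poly ^ 2 ^ 2 \<Rightarrow> 'a poly fract PGL2" where
  "generic_PGL2 A = PGL2 (map_matrix to_fract A)"

text \<open>
  \<open>deformation_lift n sm s vm v A\<close>: the family \<open>P\<^sub>t\<close> formed by the pair \<open>(vm, v)\<close>, with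
  monodromy \<open>A\<close>, consists of twisted \<open>2n\<close>-gons, satisfies \<open>P\<^sub>1 = P\<close> for \<open>P\<close> formed by
  \<open>(sm, s)\<close>, and \<open>[P\<^sub>t]\<close> is the class \<open>[P]\<^sub>t\<close>, i.e. the one with coordinates
  \<open>t o\<^sup>-\<^sub>i\<close> and \<open>o\<^sub>i\<close>. That \<open>A(1)\<close> represents the monodromy of \<open>P\<close> is a consequence.
\<close>

definition deformation_lift ::
  "nat \<Rightarrow> (int \<Rightarrow> 'a::field proj_line) \<Rightarrow> (int \<Rightarrow> 'a proj_line) \<Rightarrow>
   (int \<Rightarrow> 'a poly ^ 2) \<Rightarrow> (int \<Rightarrow> 'a poly ^ 2) \<Rightarrow> 'a poly ^ 2 ^ 2 \<Rightarrow> bool" where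
  "deformation_lift n sm s vm v A \<longleftrightarrow>
     (\<forall>i. poly_vec_at 1 (vm i) \<noteq> 0 \<and> poly_vec_at 1 (v i) \<noteq> 0) \<and>
     invertible (poly_mat_at 1 A) \<and>
     twisted_polygon (2 * n)
       (intertwine (\<lambda>i. generic_point (vm i)) (\<lambda>i. generic_point (v i))) (generic_PGL2 A) \<and>
     (\<forall>i. point (poly_vec_at 1 (vm i)) = sm i \<and> point (poly_vec_at 1 (v i)) = s i) \<and>
     (\<forall>i. o_minus (\<lambda>i. generic_point (vm i)) (\<lambda>i. generic_point (v i)) i =
            to_fract [:0, 1:] * to_fract [:o_minus sm s i:] \<and>
          o_plain (\<lambda>i. generic_point (vm i)) (\<lambda>i. generic_point (v i)) i =
            to_fract [:o_plain sm s i:])"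

text \<open>
  The tangent vector at \<open>t = 1\<close> of the family in \<open>PGL\<^sub>2\<close> represented by \<open>A\<close>, when
  \<open>A(1) = c Id\<close> represents the identity. Dividing by \<open>c\<close> normalises the representative to pass
  through \<open>Id\<close>; replacing \<open>A\<close> by \<open>f A\<close> with \<open>f(1) \<noteq> 0\<close> changes \<open>A'(1) / c\<close> by a scalar matrix.
\<close>

definition infinitesimal_monodromy :: "'a::field poly ^ 2 ^ 2 \<Rightarrow> 'a pgl2" where
  "infinitesimal_monodromy A =
     (let c = poly_mat_at 1 A $ 1 $ 1 in pgl2 (map_matrix (\<lambda>f. poly (pderiv f) 1 / c) A))"

definition chi :: "nat \<Rightarrow> (int \<Rightarrow> 'a::field) \<Rightarrow> (int \<Rightarrow> 'a) \<Rightarrow> 'a \<Rightarrow> 'a \<Rightarrow> 'a" where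
  "chi n sm s X Y = (\<Sum>i = 1..int n. (X - sm i * Y) * (X - s i * Y) / (sm i - s i))"

end

theory Submission
  imports Defs
begin

text \<open>
Number the vertices of \<open>P\<close> consecutively as \<open>p\<^sub>k\<close>, so that \<open>p\<^sub>2\<^sub>i\<close> is \<open>s\<^sup>-\<^sub>i\<close> and
\<open>p\<^sub>2\<^sub>i\<^sub>+\<^sub>1\<close> is \<open>s\<^sub>i\<close>. Both kinds of coordinates are then the same function of four
consecutive vertices, the corner ratio \<open>x\<^sub>k = [p\<^sub>k, p\<^sub>k\<^sub>+\<^sub>1, p\<^sub>k\<^sub>-\<^sub>1, p\<^sub>k\<^sub>+\<^sub>2]\<close>, and the scaling
symmetry multiplies \<open>x\<^sub>k\<close> by \<open>t\<close> for even \<open>k\<close> only.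

Let \<open>H\<^sub>k\<close> be the matrix, unique up to a scalar, that takes the points \<open>(1,0)\<close>, \<open>(0,1)\<close>,
\<open>(1,1)\<close> to \<open>p\<^sub>k\<close>, \<open>p\<^sub>k\<^sub>+\<^sub>1\<close>, \<open>p\<^sub>k\<^sub>-\<^sub>1\<close>. In the coordinates given by \<open>H\<^sub>k\<close> the next vertex
\<open>p\<^sub>k\<^sub>+\<^sub>2\<close> is \<open>(x\<^sub>k, 1)\<close>. Hence the frames satisfy, up to scalars, the moving frame equation
\<open>H\<^sub>k\<^sub>+\<^sub>1 = H\<^sub>k T(x\<^sub>k)\<close> with \<open>T(x) = ((0, x), (-1, 1))\<close> (lemma \<open>frame_step\<close>), and the monodromy
is the matrix \<open>M\<close> with \<open>H\<^sub>k\<^sub>+\<^sub>2\<^sub>n = M H\<^sub>k\<close>.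

Consider a lift of the deformation and write \<open>L(B) = B' B\<^sup>-\<^sup>1\<close> at \<open>t = 1\<close>, modulo scalar
matrices. Rescaling \<open>B\<close> by a function does not change \<open>L(B)\<close>, and
\<open>L(B C) = L(B) + B L(C) B\<^sup>-\<^sup>1\<close>. For odd \<open>k\<close> the matrix \<open>T(x\<^sub>k)\<close> is constant, so
\<open>L(H\<^sub>k\<^sub>+\<^sub>1) = L(H\<^sub>k)\<close>. For even \<open>k\<close> the logarithmic derivative of \<open>T(t x\<^sub>k)\<close> is the projection
\<open>((1, 0), (0, 0))\<close>, and conjugation by \<open>H\<^sub>k\<close> turns it into the projection onto the line
\<open>p\<^sub>k = s\<^sup>-\<^sub>i\<close> along the line \<open>p\<^sub>k\<^sub>+\<^sub>1 = s\<^sub>i\<close>. The matrix of that projection is the \<open>i\<close>-th summand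
of the asserted formula. Telescoping over one period, and using that \<open>M(1)\<close> is scalar because
\<open>P\<close> is closed, gives the formula for \<open>M'(1) = L(H\<^sub>2\<^sub>n\<^sub>+\<^sub>2) - L(H\<^sub>2)\<close>
(lemma \<open>infinitesimal_monodromy_of_lift\<close>).

A vector \<open>v\<close> is an eigenvector of a matrix \<open>B\<close> when \<open>v\<close> and \<open>B v\<close> are parallel, that is, when
their \<open>2\<close>-by-\<open>2\<close> determinant vanishes. This determinant is additive in \<open>B\<close>, and for the
projection above it is the corresponding summand of \<open>\<chi>\<^sub>P\<close> (lemma \<open>bracket_sum_projections\<close>).

A lift exists because the moving frame equation can be solved over the polynomial ring
in both directions, going backwards with adjugate matrices; the first columns of the frames are
the vertices, and the monodromy is obtained by comparing the frames at \<open>0\<close> and \<open>2n\<close>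
(lemma \<open>lift_exists\<close>).
\<close>

section \<open>Frames in the plane\<close>

definition bracket :: "'a::comm_ring_1 ^ 2 \<Rightarrow> 'a ^ 2 \<Rightarrow> 'a" where
  "bracket v w = v $ 1 * w $ 2 - v $ 2 * w $ 1"

text \<open>
The columns are multiples of \<open>a\<close> and \<open>b\<close>, and their sum is \<open>bracket a b\<close> times \<open>c\<close>; so, for
pairwise independent \<open>a\<close>, \<open>b\<close>, \<open>c\<close>, the matrix takes the standard projective frame \<open>(1,0)\<close>, \<open>(0,1)\<close>, \<open>(1,1)\<close> to the points \<open>a\<close>, \<open>b\<close>, \<open>c\<close>.
Being polynomial in \<open>a\<close>, \<open>b\<close>, \<open>c\<close>, it makes sense over \<open>F[t]\<close> as well as over \<open>F\<close>.
\<close>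

definition frame :: "'a::comm_ring_1 ^ 2 \<Rightarrow> 'a ^ 2 \<Rightarrow> 'a ^ 2 \<Rightarrow> 'a ^ 2 ^ 2" where
  "frame a b c = (\<chi> i j. if j = 1 then bracket c b * a $ i else bracket a c * b $ i)"

text \<open>
In the coordinates where \<open>p\<^sub>k\<close>, \<open>p\<^sub>k\<^sub>+\<^sub>1\<close>, \<open>p\<^sub>k\<^sub>-\<^sub>1\<close> are \<open>(1,0)\<close>, \<open>(0,1)\<close>, \<open>(1,1)\<close>, the matrix takes this
frame to the points \<open>(0,1)\<close>, \<open>(x,1)\<close>, \<open>(1,0)\<close>, which are \<open>p\<^sub>k\<^sub>+\<^sub>1\<close>, \<open>p\<^sub>k\<^sub>+\<^sub>2\<close>, \<open>p\<^sub>k\<close> when \<open>x\<close> is the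
corner ratio at \<open>k\<close>.
\<close>

definition step_matrix :: "'a::comm_ring_1 \<Rightarrow> 'a ^ 2 ^ 2" where
  "step_matrix x = vector [vector [0, x], vector [- 1, 1]]"

definition adj2 :: "'a::comm_ring_1 ^ 2 ^ 2 \<Rightarrow> 'a ^ 2 ^ 2" where
  "adj2 A = vector [vector [A $ 2 $ 2, - A $ 1 $ 2], vector [- A $ 2 $ 1, A $ 1 $ 1]]"

abbreviation mscale :: "'a::comm_ring_1 \<Rightarrow> 'a ^ 2 ^ 2 \<Rightarrow> 'a ^ 2 ^ 2" where
  "mscale c \<equiv> map_matrix ((*) c)"

lemmas mat2_simps = vec_eq_iff forall_2 sum_2 matrix_matrix_mult_def matrix_vector_mult_def
  mat_def det_2 bracket_def

lemma mscale_mscale: "mscale c (mscale d A) = mscale (c * d) A"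
  by (simp add: vec_eq_iff mult.assoc)

lemma mscale_mult_left: "mscale c A ** B = mscale c (A ** B)"
  by (simp add: mat2_simps algebra_simps)

lemma mscale_mult_right: "A ** mscale c B = mscale c (A ** B)"
  by (simp add: mat2_simps algebra_simps)

lemma adj2_mult: "A ** adj2 A = mat (det A)" "adj2 A ** A = mat (det A)"
  by (simp_all add: mat2_simps adj2_def algebra_simps)

lemma mat_mult_eq_mscale: "A ** mat c = mscale c A" "mat c ** A = mscale c A"
  by (simp_all add: mat2_simps algebra_simps)

lemma det_mscale: "det (mscale c A) = c ^ 2 * det (A :: 'a::comm_ring_1 ^ 2 ^ 2)"
  by (simp add: mat2_simps algebra_simps power2_eq_square)

lemma mult_vec_nonzero:
  fixes A :: "'a::field ^ 2 ^ 2"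
  assumes "det A \<noteq> 0" "v \<noteq> 0"
  shows "A *v v \<noteq> 0"
  using assms unfolding invertible_det_nz[symmetric]
  by (metis invertible_def matrix_left_invertible_ker)

lemma bracket_mult: "bracket (A *v v) (A *v w) = det A * bracket v w"
  by (simp add: mat2_simps algebra_simps)

lemma bracket_scale: "bracket (c *s v) w = c * bracket v w" "bracket v (c *s w) = c * bracket v w"
  by (simp_all add: mat2_simps algebra_simps)

lemma bracket_self: "bracket v v = 0"
  by (simp add: bracket_def)

lemma frame_scale: "frame (p *s a) (q *s b) (r *s c) = mscale (p * q * r) (frame a b c)"
  by (simp add: mat2_simps frame_def algebra_simps)

lemma frame_mult: "frame (A *v a) (A *v b) (A *v c) = mscale (det A) (A ** frame a b c)"
  by (simp add: mat2_simps frame_def algebra_simps)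

lemma det_frame: "det (frame a b c) = bracket c b * bracket a c * bracket a b"
  by (simp add: mat2_simps frame_def algebra_simps)

lemma det_step: "det (step_matrix x) = x"
  by (simp add: mat2_simps step_matrix_def)

text \<open>
The moving frame equation, for consecutive vertices \<open>a\<close>, \<open>b\<close>, \<open>c\<close>, \<open>d\<close>. The hypothesis is the
condition that \<open>x\<close> is the cross ratio \<open>[b, c, a, d]\<close>, cleared of denominators; the first columns
agree by inspection, the second ones by the Pluecker relation between \<open>b\<close>, \<open>c\<close>, \<open>d\<close>.
\<close>

lemma frame_step:
  assumes "bracket b a * bracket c d = x * (bracket b d * bracket c a)"
  shows "mscale (bracket b d) (frame b c a ** step_matrix x) = mscale (- bracket b a) (frame c d b)"
proof -
  have A: "bracket b d * (x * (bracket a c)) = - (bracket b a * bracket c d)"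
    using assms by (simp add: bracket_def algebra_simps)
  have 1: "bracket b d * (bracket b a * c $ i) + (bracket b d * (x * (bracket a c))) * b $ i = 
    - bracket b a * (bracket c b * d $ i)" for i
    unfolding A using exhaust_2[of i] by (auto simp: bracket_def algebra_simps)
  from 1[of 1] 1[of 2] show ?thesis
    by (simp add: mat2_simps(1-6) step_matrix_def frame_def algebra_simps)
qed

section \<open>Points, projective maps and eigenvectors in homogeneous coordinates\<close>

lemma wedge_eq_bracket: "wedge = bracket"
  by (simp add: fun_eq_iff wedge_def bracket_def)

lemma bracket_eq_0_iff:
  fixes v w :: "'a::field ^ 2"
  assumes "v \<noteq> 0" "w \<noteq> 0"
  shows "bracket v w = 0 \<longleftrightarrow> (\<exists>c. c \<noteq> 0 \<and> w = c *s v)"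
proof
  assume b: "bracket v w = 0"
  show "\<exists>c. c \<noteq> 0 \<and> w = c *s v"
  proof (cases "v $ 1 = 0")
    case True
    then show ?thesis using assms b
      by (intro exI[of _ "w $ 2 / v $ 2"]) (auto simp: mat2_simps field_simps)
  next
    case False
    then show ?thesis using assms b
      by (intro exI[of _ "w $ 1 / v $ 1"]) (auto simp: mat2_simps field_simps)
  qed
qed (auto simp: bracket_def algebra_simps)

lemma point_eq_iff:
  fixes v w :: "'a::field ^ 2"
  assumes "v \<noteq> 0" "w \<noteq> 0"
  shows "point v = point w \<longleftrightarrow> bracket v w = 0"
proof -
  have refl: "\<exists>c. c \<noteq> 0 \<and> u = c *s u" for u :: "'a ^ 2"
    by (intro exI[of _ 1]) simp
  show ?thesis
    using Quotient_rel[OF Quotient_proj_line, of v w] refl assms bracket_eq_0_iff[OF assms] by auto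
qed

lemma cross_ratio_point:
  fixes a b c d :: "'a::field ^ 2"
  assumes "a \<noteq> 0" "b \<noteq> 0" "c \<noteq> 0" "d \<noteq> 0"
  shows "cross_ratio (point a) (point b) (point c) (point d) =
    bracket a c / bracket a d * (bracket b d / bracket b c)"
proof -
  have refl: "\<exists>c. c \<noteq> 0 \<and> u = c *s u" for u :: "'a ^ 2"
    by (intro exI[of _ 1]) simp
  show ?thesis
    using assms refl by (subst cross_ratio.abs_eq) (auto simp: wedge_eq_bracket)
qed

lemma PGL2_act_point:
  fixes A :: "'a::field ^ 2 ^ 2"
  assumes "invertible A" "v \<noteq> 0"
  shows "PGL2_act (PGL2 A) (point v) = point (A *v v)"
proof -
  have refl: "\<exists>c. c \<noteq> 0 \<and> u = c *s u" for u :: "'a ^ 2"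
    by (intro exI[of _ 1]) simp
  have refl': "\<exists>c. c \<noteq> 0 \<and> u = mscale c u" for u :: "'a ^ 2 ^ 2"
    by (intro exI[of _ 1]) (simp add: vec_eq_iff)
  show ?thesis
    using assms refl refl' by (subst PGL2_act.abs_eq) auto
qed

lemma PGL2_act_id_point: "v \<noteq> 0 \<Longrightarrow> PGL2_act PGL2_id (point v) = point v"
  unfolding PGL2_id_def by (subst PGL2_act_point) (auto simp: invertible_det_nz)

lemma pgl2_eq_iff: "pgl2 A = pgl2 B \<longleftrightarrow> (\<exists>c. B = A + mat c)"
  by (simp add: pgl2.abs_eq_iff)

text \<open>
Eliminating the eigenvalue leaves a quantity that is additive in the matrix, so that it can be
computed summand by summand.
\<close>

lemma pgl2_eigenvector_iff:
  "pgl2_eigenvector (pgl2 A) v \<longleftrightarrow> v \<noteq> 0 \<and> bracket v (A *v v) = 0"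
proof (cases "v = 0 \<or> A *v v = 0")
  case True
  then show ?thesis by (auto simp: pgl2_eigenvector.abs_eq bracket_def intro!: exI[of _ 0])
next
  case False
  then show ?thesis using bracket_eq_0_iff[of v "A *v v"]
    by (auto simp: pgl2_eigenvector.abs_eq)
qed

section \<open>Polynomial families and their generic points\<close>

lemma poly_bracket: "poly (bracket v w) t = bracket (poly_vec_at t v) (poly_vec_at t w)"
  by (simp add: bracket_def poly_vec_at_def)

lemma poly_det: "poly (det A) t = det (poly_mat_at t A)"
  by (simp add: det_2 poly_mat_at_def)

lemma poly_mat_at_mult: "poly_mat_at t (A ** B) = poly_mat_at t A ** poly_mat_at t B"
  by (simp add: mat2_simps poly_mat_at_def)

lemma poly_mat_at_mult_vec: "poly_vec_at t (A *v v) = poly_mat_at t A *v poly_vec_at t v"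
  by (simp add: mat2_simps poly_mat_at_def poly_vec_at_def)

lemma poly_mat_at_mscale: "poly_mat_at t (mscale f A) = mscale (poly f t) (poly_mat_at t A)"
  by (simp add: vec_eq_iff poly_mat_at_def)

lemma poly_vec_at_scale: "poly_vec_at t (f *s v) = poly f t *s poly_vec_at t v"
  by (simp add: vec_eq_iff poly_vec_at_def)

lemma poly_mat_at_frame:
  "poly_mat_at t (frame a b c) = frame (poly_vec_at t a) (poly_vec_at t b) (poly_vec_at t c)"
  by (simp add: mat2_simps frame_def poly_mat_at_def poly_vec_at_def)

lemma poly_mat_at_step: "poly_mat_at t (step_matrix x) = step_matrix (poly x t)"
  by (simp add: mat2_simps step_matrix_def poly_mat_at_def)

lemma poly_mat_at_adj2: "poly_mat_at t (adj2 A) = adj2 (poly_mat_at t A)"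
  by (simp add: mat2_simps adj2_def poly_mat_at_def)

lemma poly_vec_at_nonzeroD: "poly_vec_at t v \<noteq> 0 \<Longrightarrow> v \<noteq> 0"
  by (erule contrapos_nn) (simp add: poly_vec_at_def vec_eq_iff)

definition fract_vec :: "'a::field poly ^ 2 \<Rightarrow> 'a poly fract ^ 2" where
  "fract_vec v = (\<chi> i. to_fract (v $ i))"

lemma bracket_fract_vec: "bracket (fract_vec v) (fract_vec w) = to_fract (bracket v w)"
  by (simp add: bracket_def fract_vec_def)

lemma fract_vec_eq_0_iff: "fract_vec v = 0 \<longleftrightarrow> v = 0"
  by (simp add: fract_vec_def vec_eq_iff)

lemma generic_point_eq: "generic_point v = point (fract_vec v)"
  by (simp add: generic_point_def fract_vec_def)

lemma generic_point_eq_iff_bracket: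
  assumes "v \<noteq> 0" "w \<noteq> 0"
  shows "generic_point v = generic_point w \<longleftrightarrow> bracket v w = 0"
  using assms by (simp add: generic_point_eq point_eq_iff fract_vec_eq_0_iff bracket_fract_vec)

text \<open>
Two polynomial vectors that give the same point over \<open>F(t)\<close> are proportional over \<open>F[t]\<close>. If
neither of them vanishes at \<open>t = 1\<close>, the factors can be taken not to vanish there either: they are
coordinates of the two vectors, for an index at which both values at \<open>1\<close> are nonzero.
This is what makes it possible to differentiate at \<open>t = 1\<close>.
\<close>

lemma generic_point_eq_iff_scale:
  assumes v: "poly_vec_at 1 v \<noteq> 0" and w: "poly_vec_at 1 w \<noteq> 0"
  shows "generic_point v = generic_point w \<longleftrightarrow>
    (\<exists>f g. poly f 1 \<noteq> 0 \<and> poly g 1 \<noteq> 0 \<and> f *s v = g *s w)"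
proof
  have nz: "v \<noteq> 0" "w \<noteq> 0" using assms poly_vec_at_nonzeroD by blast+
  assume "generic_point v = generic_point w"
  then have b: "bracket v w = 0" using nz by (simp add: generic_point_eq_iff_bracket)
  then have b1: "poly (v $ 1) 1 * poly (w $ 2) 1 = poly (v $ 2) 1 * poly (w $ 1) 1"
    by (simp add: bracket_def flip: poly_mult)
  have "poly (v $ 1) 1 \<noteq> 0 \<and> poly (w $ 1) 1 \<noteq> 0 \<or> poly (v $ 2) 1 \<noteq> 0 \<and> poly (w $ 2) 1 \<noteq> 0"
    using v w b1 by (auto simp: poly_vec_at_def vec_eq_iff forall_2)
  then show "\<exists>f g. poly f 1 \<noteq> 0 \<and> poly g 1 \<noteq> 0 \<and> f *s v = g *s w"
  proof
    assume "poly (v $ 1) 1 \<noteq> 0 \<and> poly (w $ 1) 1 \<noteq> 0"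
    then show ?thesis using b
      by (intro exI[of _ "w $ 1"] exI[of _ "v $ 1"]) (auto simp: mat2_simps algebra_simps)
  next
    assume "poly (v $ 2) 1 \<noteq> 0 \<and> poly (w $ 2) 1 \<noteq> 0"
    then show ?thesis using b
      by (intro exI[of _ "w $ 2"] exI[of _ "v $ 2"]) (auto simp: mat2_simps algebra_simps)
  qed
next
  have nz: "v \<noteq> 0" "w \<noteq> 0" using assms poly_vec_at_nonzeroD by blast+
  assume "\<exists>f g. poly f 1 \<noteq> 0 \<and> poly g 1 \<noteq> 0 \<and> f *s v = g *s w"
  then obtain f g where fg: "poly f 1 \<noteq> 0" "f *s v = g *s w" by blast
  have "f * bracket v w = bracket (f *s v) w" by (simp add: bracket_scale)
  also have "\<dots> = 0" by (simp add: fg bracket_scale bracket_self)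
  finally have "bracket v w = 0" using fg(1) by auto
  then show "generic_point v = generic_point w" using nz by (simp add: generic_point_eq_iff_bracket)
qed

lemma PGL2_act_generic_point:
  assumes "invertible (poly_mat_at 1 A)" "v \<noteq> 0"
  shows "PGL2_act (generic_PGL2 A) (generic_point v) = generic_point (A *v v)"
proof -
  have "poly (det A) 1 \<noteq> 0" using assms(1) by (simp add: invertible_det_nz poly_det)
  then have "det A \<noteq> 0" by auto
  moreover have "det (map_matrix to_fract A) = to_fract (det A)" by (simp add: det_2)
  ultimately have "invertible (map_matrix to_fract A)" by (simp add: invertible_det_nz)
  moreover have "map_matrix to_fract A *v fract_vec v = fract_vec (A *v v)"
    by (simp add: mat2_simps fract_vec_def)
  ultimately show ?thesis using assms(2)
    by (simp add: generic_PGL2_def generic_point_eq PGL2_act_point fract_vec_eq_0_iff)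
qed

section \<open>Projective equality near t = 1\<close>

text \<open>
For matrices invertible at \<open>t = 1\<close>, this is equality in \<open>PGL\<^sub>2\<close> of the local ring of \<open>F[t]\<close> at \<open>t = 1\<close>. Over \<open>F(t)\<close> alone, factors with a zero
at \<open>t = 1\<close> would be allowed, and neither values nor derivatives at \<open>1\<close> could be compared.
\<close>

definition proj_eq_at_1 :: "'a::field poly ^ 2 ^ 2 \<Rightarrow> 'a poly ^ 2 ^ 2 \<Rightarrow> bool" where
  "proj_eq_at_1 B C \<longleftrightarrow> (\<exists>f g. poly f 1 \<noteq> 0 \<and> poly g 1 \<noteq> 0 \<and> mscale f B = mscale g C)"

lemma proj_eqI: "mscale f B = mscale g C \<Longrightarrow> poly f 1 \<noteq> 0 \<Longrightarrow> poly g 1 \<noteq> 0 \<Longrightarrow> proj_eq_at_1 B C"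
  unfolding proj_eq_at_1_def by blast

lemma proj_eq_refl: "proj_eq_at_1 B B"
  by (rule proj_eqI[of 1 _ 1]) simp_all

lemma proj_eq_sym: "proj_eq_at_1 B C \<Longrightarrow> proj_eq_at_1 C B"
  unfolding proj_eq_at_1_def by metis

lemma proj_eq_trans [trans]:
  assumes "proj_eq_at_1 B C" "proj_eq_at_1 C D"
  shows "proj_eq_at_1 B D"
proof -
  obtain f g where fg: "poly f 1 \<noteq> 0" "poly g 1 \<noteq> 0" "mscale f B = mscale g C"
    using assms(1) unfolding proj_eq_at_1_def by blast
  obtain h k where hk: "poly h 1 \<noteq> 0" "poly k 1 \<noteq> 0" "mscale h C = mscale k D"
    using assms(2) unfolding proj_eq_at_1_def by blast
  have "mscale (h * f) B = mscale (g * k) D"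
    by (metis fg(3) hk(3) mscale_mscale mult.commute)
  then show ?thesis using fg hk by (intro proj_eqI[of "h * f" _ "g * k"]) auto
qed

lemma proj_eq_mult_left: "proj_eq_at_1 B C \<Longrightarrow> proj_eq_at_1 (A ** B) (A ** C)"
  unfolding proj_eq_at_1_def by (metis mscale_mult_right)

lemma proj_eq_mult_right: "proj_eq_at_1 B C \<Longrightarrow> proj_eq_at_1 (B ** A) (C ** A)"
  unfolding proj_eq_at_1_def by (metis mscale_mult_left)

lemma proj_eq_mscale: "poly f 1 \<noteq> 0 \<Longrightarrow> proj_eq_at_1 (mscale f B) B"
  by (rule proj_eqI[of 1 _ f]) (simp_all add: vec_eq_iff)

lemma proj_eq_mult_right_cancel:
  assumes "proj_eq_at_1 (B ** T) (C ** T)" "poly (det T) 1 \<noteq> 0"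
  shows "proj_eq_at_1 B C"
proof -
  have *: "X ** T ** adj2 T = mscale (det T) X" for X
    by (simp add: adj2_mult mat_mult_eq_mscale flip: matrix_mul_assoc)
  show ?thesis
    using proj_eq_mult_right[OF assms(1), of "adj2 T"] proj_eq_mscale[OF assms(2)]
    unfolding * by (meson proj_eq_trans proj_eq_sym)
qed

lemma proj_eq_mult_vec:
  assumes "proj_eq_at_1 B C"
  shows "\<exists>f g. poly f 1 \<noteq> 0 \<and> poly g 1 \<noteq> 0 \<and> f *s (B *v v) = g *s (C *v v)"
proof -
  have "mscale f X *v v = f *s (X *v v)" for f X
    by (simp add: mat2_simps algebra_simps)
  then show ?thesis using assms unfolding proj_eq_at_1_def by metis
qed

section \<open>Logarithmic derivatives modulo scalars\<close>

abbreviation mat_deriv :: "'a::field poly ^ 2 ^ 2 \<Rightarrow> 'a ^ 2 ^ 2" where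
  "mat_deriv B \<equiv> poly_mat_at 1 (map_matrix pderiv B)"

text \<open>
\<open>D\<close> represents \<open>B' B\<^sup>-\<^sup>1\<close> at \<open>t = 1\<close> in \<open>pgl\<^sub>2\<close>. This is a relation rather than a function to \<open>pgl2\<close>
so that representatives can be added and telescoped as matrices.
\<close>

definition has_log_deriv :: "'a::field poly ^ 2 ^ 2 \<Rightarrow> 'a ^ 2 ^ 2 \<Rightarrow> bool" where
  "has_log_deriv B D \<longleftrightarrow> (\<exists>c. mat_deriv B = (D + mat c) ** poly_mat_at 1 B)"

lemma mat_deriv_mult:
  "mat_deriv (B ** C) = mat_deriv B ** poly_mat_at 1 C + poly_mat_at 1 B ** mat_deriv C"
  by (simp add: mat2_simps poly_mat_at_def pderiv_mult pderiv_add algebra_simps)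

lemma mat_deriv_mscale:
  "mat_deriv (mscale f B) = mscale (poly (pderiv f) 1) (poly_mat_at 1 B) + mscale (poly f 1) (mat_deriv B)"
  by (simp add: mat2_simps poly_mat_at_def pderiv_mult pderiv_add algebra_simps)

text \<open>
A scalar factor \<open>f\<close> adds the scalar matrix \<open>f'(1) / f(1)\<close> to the logarithmic derivative.
\<close>

lemma has_log_deriv_mscale_iff:
  assumes "poly f 1 \<noteq> 0"
  shows "has_log_deriv (mscale f B) D \<longleftrightarrow> has_log_deriv B D"
proof -
  have *: "mat_deriv (mscale f B) = (D + mat (c + poly (pderiv f) 1 / poly f 1)) ** poly_mat_at 1 (mscale f B)
      \<longleftrightarrow> mat_deriv B = (D + mat c) ** poly_mat_at 1 B" for c
  proof -
    have "(D + mat (c + poly (pderiv f) 1 / poly f 1)) ** poly_mat_at 1 (mscale f B) =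
        mscale (poly (pderiv f) 1) (poly_mat_at 1 B) + mscale (poly f 1) ((D + mat c) ** poly_mat_at 1 B)"
      unfolding poly_mat_at_mscale using assms by (simp add: mat2_simps field_simps)
    then show ?thesis
      using assms by (simp add: mat_deriv_mscale) (simp add: vec_eq_iff)
  qed
  show ?thesis
    unfolding has_log_deriv_def
  proof (safe, goal_cases)
    case (1 c)
    then show ?case using *[of "c - poly (pderiv f) 1 / poly f 1"] by auto
  next
    case (2 c)
    then show ?case using * by blast
  qed
qed

lemma has_log_deriv_proj_eq: "proj_eq_at_1 B C \<Longrightarrow> has_log_deriv B D \<Longrightarrow> has_log_deriv C D"
  unfolding proj_eq_at_1_def using has_log_deriv_mscale_iff by metis

text \<open>
The product rule \<open>L(B C) = L(B) + B L(C) B\<^sup>-\<^sup>1\<close>, where \<open>E\<close> stands for \<open>L(C)\<close> and \<open>Q\<close> for its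
conjugate by \<open>B(1)\<close>.
\<close>

lemma has_log_deriv_mult:
  assumes "has_log_deriv B D" "mat_deriv C = E ** poly_mat_at 1 C"
    and "poly_mat_at 1 B ** E = Q ** poly_mat_at 1 B"
  shows "has_log_deriv (B ** C) (D + Q)"
proof -
  obtain c where c: "mat_deriv B = (D + mat c) ** poly_mat_at 1 B"
    using assms(1) unfolding has_log_deriv_def by blast
  have "mat_deriv (B ** C) = (D + mat c) ** poly_mat_at 1 B ** poly_mat_at 1 C
      + poly_mat_at 1 B ** E ** poly_mat_at 1 C"
    by (simp add: mat_deriv_mult c assms(2) matrix_mul_assoc)
  also have "\<dots> = (D + Q + mat c) ** poly_mat_at 1 (B ** C)"
    unfolding assms(3) poly_mat_at_mult matrix_mul_assoc by (simp add: mat2_simps algebra_simps)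
  finally show ?thesis unfolding has_log_deriv_def by blast
qed

text \<open>
The product rule for a left factor \<open>A\<close> with \<open>A(1)\<close> scalar: conjugation by \<open>A(1)\<close> does nothing, so
the contribution of \<open>A\<close> is its own tangent vector.
\<close>

lemma has_log_deriv_scalar_mult:
  assumes "poly_mat_at 1 A = mat c" "c \<noteq> 0" "has_log_deriv B D"
  shows "has_log_deriv (A ** B) (D + mscale (1 / c) (mat_deriv A))"
proof -
  obtain d where d: "mat_deriv B = (D + mat d) ** poly_mat_at 1 B"
    using assms(3) unfolding has_log_deriv_def by blast
  have "mat_deriv (A ** B) = (D + mscale (1 / c) (mat_deriv A) + mat d) ** poly_mat_at 1 (A ** B)"
    unfolding mat_deriv_mult poly_mat_at_mult d assms(1) using assms(2)
    by (simp add: mat2_simps field_simps)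
  then show ?thesis unfolding has_log_deriv_def by blast
qed

lemma has_log_deriv_exists:
  assumes "det (poly_mat_at 1 B) \<noteq> 0"
  shows "\<exists>D. has_log_deriv B D"
proof -
  let ?D = "mscale (1 / det (poly_mat_at 1 B)) (mat_deriv B ** adj2 (poly_mat_at 1 B))"
  have "mat_deriv B = ?D ** poly_mat_at 1 B"
    using assms by (simp add: mscale_mult_left adj2_mult mat_mult_eq_mscale mscale_mscale vec_eq_iff
      flip: matrix_mul_assoc)
  then show ?thesis unfolding has_log_deriv_def by (metis add.right_neutral mat_0)
qed

lemma has_log_deriv_unique:
  assumes "det (poly_mat_at 1 B) \<noteq> 0" "has_log_deriv B D" "has_log_deriv B E"
  shows "\<exists>c. E = D + mat c"
proof -
  obtain c where "mat_deriv B = (D + mat c) ** poly_mat_at 1 B"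
    using assms(2) unfolding has_log_deriv_def by blast
  moreover obtain d where "mat_deriv B = (E + mat d) ** poly_mat_at 1 B"
    using assms(3) unfolding has_log_deriv_def by blast
  moreover obtain B' where "poly_mat_at 1 B ** B' = mat 1"
    using assms(1) unfolding invertible_det_nz[symmetric] invertible_def by blast
  ultimately have "D + mat c = E + mat d"
    by (metis matrix_mul_assoc matrix_mul_rid)
  then have "E = D + mat (c - d)"
    by (simp add: mat2_simps algebra_simps)
  then show ?thesis by blast
qed

section \<open>Polygons and their corner ratios\<close>

lemma intertwine_even [simp]: "intertwine f g (2 * i) = f i"
  and intertwine_odd [simp]: "intertwine f g (2 * i + 1) = g i"
  by (simp_all add: intertwine_def)

lemma intertwine_map: "intertwine (\<lambda>i. F (f i)) (\<lambda>i. F (g i)) = (\<lambda>k. F (intertwine f g k))"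
  by (auto simp: intertwine_def)

lemma all_int_iff_even_odd: "(\<forall>k :: int. Q k) \<longleftrightarrow> (\<forall>i. Q (2 * i) \<and> Q (2 * i + 1))"
  by (metis evenE oddE)

definition corner_ratio :: "(int \<Rightarrow> 'a::field proj_line) \<Rightarrow> int \<Rightarrow> 'a" where
  "corner_ratio p k = cross_ratio (p k) (p (k + 1)) (p (k - 1)) (p (k + 2))"

lemma corner_ratio_intertwine:
  "corner_ratio (intertwine f g) (2 * i) = o_minus f g i"
  "corner_ratio (intertwine f g) (2 * i + 1) = o_plain f g i"
proof -
  have "(2 * i - 1) div 2 = i - 1" by presburger
  then show "corner_ratio (intertwine f g) (2 * i) = o_minus f g i"
    "corner_ratio (intertwine f g) (2 * i + 1) = o_plain f g i"
    by (simp_all add: corner_ratio_def o_minus_def o_plain_def intertwine_def add.commute)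
qed

definition deformed_ratio :: "(int \<Rightarrow> 'a::field) \<Rightarrow> int \<Rightarrow> 'a poly" where
  "deformed_ratio x k = (if even k then [:0, x k:] else [:x k:])"

text \<open>
With the vertices of the intertwined polygon as one sequence, the conditions on the two families of
coordinates become one condition on the corner ratios.
\<close>

lemma deformation_lift_iff:
  "deformation_lift n sm s vm v A \<longleftrightarrow>
    (\<forall>k. poly_vec_at 1 (intertwine vm v k) \<noteq> 0) \<and> invertible (poly_mat_at 1 A) \<and>
    twisted_polygon (2 * n) (\<lambda>k. generic_point (intertwine vm v k)) (generic_PGL2 A) \<and>
    (\<forall>k. point (poly_vec_at 1 (intertwine vm v k)) = intertwine sm s k) \<and>
    (\<forall>k. corner_ratio (\<lambda>k. generic_point (intertwine vm v k)) k =
        to_fract (deformed_ratio (corner_ratio (intertwine sm s)) k))"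
proof -
  let ?p = "\<lambda>k. generic_point (intertwine vm v k)"
  have p: "intertwine (\<lambda>i. generic_point (vm i)) (\<lambda>i. generic_point (v i)) = ?p"
    by (rule intertwine_map)
  have t: "to_fract [:0, 1:] * to_fract [:a:] = to_fract [:0, a:]" for a :: 'a
    by (simp flip: to_fract_mult)
  have 1: "(\<forall>k. poly_vec_at 1 (intertwine vm v k) \<noteq> 0) \<longleftrightarrow>
      (\<forall>i. poly_vec_at 1 (vm i) \<noteq> 0 \<and> poly_vec_at 1 (v i) \<noteq> 0)"
    by (subst all_int_iff_even_odd) simp
  have 2: "(\<forall>k. point (poly_vec_at 1 (intertwine vm v k)) = intertwine sm s k) \<longleftrightarrow>
      (\<forall>i. point (poly_vec_at 1 (vm i)) = sm i \<and> point (poly_vec_at 1 (v i)) = s i)"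
    by (subst all_int_iff_even_odd) simp
  have 3: "(\<forall>k. corner_ratio ?p k = to_fract (deformed_ratio (corner_ratio (intertwine sm s)) k)) \<longleftrightarrow>
    (\<forall>i. o_minus (\<lambda>i. generic_point (vm i)) (\<lambda>i. generic_point (v i)) i =
            to_fract [:0, 1:] * to_fract [:o_minus sm s i:] \<and>
          o_plain (\<lambda>i. generic_point (vm i)) (\<lambda>i. generic_point (v i)) i =
            to_fract [:o_plain sm s i:])"
    unfolding p[symmetric] t
    by (subst all_int_iff_even_odd) (simp add: corner_ratio_intertwine deformed_ratio_def)
  show ?thesis
    unfolding deformation_lift_def 1 2 3 p by blast
qed

lemma cross_ratio_generic_point_iff:
  assumes "bracket a d \<noteq> 0" "bracket b c \<noteq> 0"
  shows "cross_ratio (generic_point a) (generic_point b) (generic_point c) (generic_point d) = to_fract x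
    \<longleftrightarrow> bracket a c * bracket b d = x * (bracket a d * bracket b c)"
proof -
  have "a \<noteq> 0" "b \<noteq> 0" "c \<noteq> 0" "d \<noteq> 0" using assms by (auto simp: bracket_def)
  then show ?thesis using assms
    by (simp add: generic_point_eq cross_ratio_point fract_vec_eq_0_iff bracket_fract_vec
        field_simps flip: to_fract_mult)
qed

section \<open>The infinitesimal monodromy of a lift\<close>

abbreviation affine_vec :: "'a::field \<Rightarrow> 'a ^ 2" where
  "affine_vec a \<equiv> vector [a, 1]"

lemma affine_vec_nonzero: "affine_vec a \<noteq> 0"
  by (simp add: vec_eq_iff forall_2)

lemma bracket_affine_vec: "bracket (affine_vec a) (affine_vec b) = a - b"
  by (simp add: bracket_def)

lemma affine_point_eq_iff: "affine_point a = affine_point b \<longleftrightarrow> a = b"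
  by (simp add: affine_point_def point_eq_iff affine_vec_nonzero bracket_affine_vec)

text \<open>
For \<open>a \<noteq> b\<close>, the linear projection of the plane onto the line spanned by \<open>(a, 1)\<close> along the line
spanned by \<open>(b, 1)\<close>.
\<close>

definition projection :: "'a::field \<Rightarrow> 'a \<Rightarrow> 'a ^ 2 ^ 2" where
  "projection a b = mscale (1 / (a - b)) (vector [vector [a, - a * b], vector [1, - b]])"

text \<open>
The frame matrix takes \<open>(1,0)\<close> and \<open>(0,1)\<close> to multiples of \<open>(a, 1)\<close> and \<open>(b, 1)\<close>, so it conjugates the
coordinate projection to the projection between these lines.
\<close>

lemma frame_projection:
  assumes "a \<noteq> b"
  shows "frame (affine_vec a) (affine_vec b) c ** vector [vector [1, 0], vector [0, 0]] =
    projection a b ** frame (affine_vec a) (affine_vec b) c"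
proof -
  let ?F = "frame (affine_vec a) (affine_vec b) c" and ?E = "vector [vector [1, 0], vector [0, 0]]"
  have "vector [vector [a, - a * b], vector [1, - b]] ** ?F = mscale (a - b) (?F ** ?E)"
    by (simp add: mat2_simps(1-6) frame_def algebra_simps)
  then show ?thesis
    using assms by (simp add: projection_def mscale_mult_left mscale_mscale) (simp add: vec_eq_iff)
qed

text \<open>
The next two lemmas give \<open>L(T(x))\<close> for a corner ratio that stays fixed and for one that is scaled
by \<open>t\<close>. The values are \<open>0\<close> and the coordinate projection onto \<open>(1,0)\<close>; the latter does not depend on \<open>x\<close>.
\<close>

lemma mat_deriv_step_const: "mat_deriv (step_matrix [:x:]) = 0 ** poly_mat_at 1 (step_matrix [:x:])"
  by (simp add: mat2_simps step_matrix_def poly_mat_at_def pderiv_minus)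

lemma mat_deriv_step_linear:
  "mat_deriv (step_matrix [:0, x:]) =
    vector [vector [1, 0], vector [0, 0]] ** poly_mat_at 1 (step_matrix [:0, x:])"
  by (simp add: mat2_simps step_matrix_def poly_mat_at_def pderiv_pCons pderiv_minus)

text \<open>
A monodromy that moves the vertices by a shift of the index also moves the frames: a frame is
determined projectively by its three points and is equivariant under linear maps.
\<close>

lemma twisted_frames:
  assumes V: "\<And>k. poly_vec_at 1 (V k) \<noteq> 0"
    and inv: "invertible (poly_mat_at 1 A)"
    and mono: "\<And>k. generic_point (V (k + m)) = PGL2_act (generic_PGL2 A) (generic_point (V k))"
  shows "proj_eq_at_1 (A ** frame (V i) (V j) (V k)) (frame (V (i + m)) (V (j + m)) (V (k + m)))"
proof -
  have dA: "poly (det A) 1 \<noteq> 0" using inv by (simp add: invertible_det_nz poly_det)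
  have "\<exists>f g. poly f 1 \<noteq> 0 \<and> poly g 1 \<noteq> 0 \<and> f *s V (k + m) = g *s (A *v V k)" for k
  proof -
    have "poly_vec_at 1 (A *v V k) \<noteq> 0"
      using inv V[of k] by (simp add: poly_mat_at_mult_vec mult_vec_nonzero invertible_det_nz)
    then show ?thesis
      using mono[of k] V[of "k + m"] inv poly_vec_at_nonzeroD[OF V[of k]]
      by (simp add: PGL2_act_generic_point generic_point_eq_iff_scale)
  qed
  then obtain f g where f: "\<And>k. poly (f k) 1 \<noteq> 0" and g: "\<And>k. poly (g k) 1 \<noteq> 0"
    and fg: "\<And>k. f k *s V (k + m) = g k *s (A *v V k)"
    by metis
  have "mscale (f i * f j * f k) (frame (V (i + m)) (V (j + m)) (V (k + m))) =
      mscale (g i * g j * g k * det A) (A ** frame (V i) (V j) (V k))"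
    by (simp add: fg frame_mult mscale_mscale flip: frame_scale)
      (simp add: frame_scale frame_mult mscale_mscale)
  then show ?thesis using f g dA
    by (intro proj_eqI[of "g i * g j * g k * det A" _ "f i * f j * f k"]) simp_all
qed

text \<open>
The logarithmic derivatives of the frames are telescoped from \<open>H\<^sub>2\<close> to \<open>H\<^sub>2\<^sub>n\<^sub>+\<^sub>2\<close>, two steps at a time.
On the other hand \<open>H\<^sub>2\<^sub>n\<^sub>+\<^sub>2\<close> is \<open>A H\<^sub>2\<close> projectively, and \<open>A(1)\<close> is scalar because it preserves a frame;
so the same logarithmic derivative is that of \<open>H\<^sub>2\<close> plus \<open>A'(1) / A(1)\<close>.
\<close>

lemma infinitesimal_monodromy_of_lift:
  fixes q :: "int \<Rightarrow> 'a::field"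
  assumes V: "\<And>k. poly_vec_at 1 (V k) \<noteq> 0"
    and inv: "invertible (poly_mat_at 1 A)"
    and mono: "\<And>k. generic_point (V (k + 2 * int n)) = PGL2_act (generic_PGL2 A) (generic_point (V k))"
    and base: "\<And>k. point (poly_vec_at 1 (V k)) = affine_point (q k)"
    and ratio: "\<And>k. corner_ratio (\<lambda>k. generic_point (V k)) k = to_fract (deformed_ratio x k)"
    and dist: "\<And>k. q k \<noteq> q (k + 1)" "\<And>k. q k \<noteq> q (k + 2)"
    and per: "\<And>k. q (k + 2 * int n) = q k"
  shows "infinitesimal_monodromy A = pgl2 (\<Sum>i = 1..int n. projection (q (2 * i)) (q (2 * i + 1)))"
proof -
  have "\<exists>c. c \<noteq> 0 \<and> poly_vec_at 1 (V k) = c *s affine_vec (q k)" for k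
    using base[of k] V[of k] affine_vec_nonzero[of "q k"]
      bracket_eq_0_iff[of "affine_vec (q k)" "poly_vec_at 1 (V k)"]
      point_eq_iff[of "affine_vec (q k)" "poly_vec_at 1 (V k)"]
    by (simp add: affine_point_def)
  then obtain c where c: "\<And>k. c k \<noteq> 0" and Vc: "\<And>k. poly_vec_at 1 (V k) = c k *s affine_vec (q k)"
    by metis
  have br: "poly (bracket (V k) (V l)) 1 = c k * c l * (q k - q l)" for k l
    by (simp add: poly_bracket Vc bracket_scale bracket_affine_vec)
  have dist': "q k \<noteq> q (k - 1)" "q (k + 1) \<noteq> q (k - 1)" for k
    using dist(1)[of "k - 1"] dist(2)[of "k - 1"] by (simp_all add: eq_commute add.commute)
  define H where "H k = frame (V k) (V (k + 1)) (V (k - 1))" for k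
  define F where "F k = frame (affine_vec (q k)) (affine_vec (q (k + 1))) (affine_vec (q (k - 1)))" for k
  have H1: "poly_mat_at 1 (H k) = mscale (c k * c (k + 1) * c (k - 1)) (F k)" for k
    by (simp add: H_def F_def poly_mat_at_frame Vc frame_scale)
  have detH: "det (poly_mat_at 1 (H k)) \<noteq> 0" for k
    using dist(1)[of k] dist'[of k] c by (auto simp: H1 det_mscale F_def det_frame bracket_affine_vec)
  have step: "proj_eq_at_1 (H k ** step_matrix (deformed_ratio x k)) (H (k + 1))" for k
  proof -
    have nz: "poly (bracket (V k) (V (k + 2))) 1 \<noteq> 0" "poly (bracket (V (k + 1)) (V (k - 1))) 1 \<noteq> 0"
       "poly (bracket (V k) (V (k - 1))) 1 \<noteq> 0"
      using c dist dist' by (simp_all add: br)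
    then have "bracket (V k) (V (k + 2)) \<noteq> 0" "bracket (V (k + 1)) (V (k - 1)) \<noteq> 0"
      by auto
    then have "bracket (V k) (V (k - 1)) * bracket (V (k + 1)) (V (k + 2)) =
        deformed_ratio x k * (bracket (V k) (V (k + 2)) * bracket (V (k + 1)) (V (k - 1)))"
      using ratio[of k] by (simp add: corner_ratio_def cross_ratio_generic_point_iff)
    from frame_step[OF this] show ?thesis using nz
      by (intro proj_eqI[of "bracket (V k) (V (k + 2))" _ "- bracket (V k) (V (k - 1))"])
        (simp_all add: H_def add.commute)
  qed
  \<comment> \<open>The even step contributes the projection, the odd step contributes nothing.\<close>
  have double_step: "has_log_deriv (H (2 * i + 2)) (D + projection (q (2 * i)) (q (2 * i + 1)))"
    if D: "has_log_deriv (H (2 * i)) D" for i D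
  proof -
    let ?Q = "projection (q (2 * i)) (q (2 * i + 1))"
    let ?E = "vector [vector [1, 0], vector [0, 0]]"
    have "poly_mat_at 1 (H (2 * i)) ** ?E = ?Q ** poly_mat_at 1 (H (2 * i))"
      using dist(1)[of "2 * i"]
      by (simp add: H1 mscale_mult_left mscale_mult_right F_def frame_projection)
    then have "has_log_deriv (H (2 * i) ** step_matrix (deformed_ratio x (2 * i))) (D + ?Q)"
      using D by (intro has_log_deriv_mult[where E = ?E])
        (simp_all add: deformed_ratio_def mat_deriv_step_linear)
    then have 1: "has_log_deriv (H (2 * i + 1)) (D + ?Q)"
      using step[of "2 * i"] by (rule has_log_deriv_proj_eq[rotated])
    have "has_log_deriv (H (2 * i + 1) ** step_matrix (deformed_ratio x (2 * i + 1))) (D + ?Q + 0)"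
      using 1 by (intro has_log_deriv_mult[where E = 0])
        (simp_all add: deformed_ratio_def mat_deriv_step_const)
    then have "has_log_deriv (H (2 * i + 1 + 1)) (D + ?Q + 0)"
      using step[of "2 * i + 1"] by (rule has_log_deriv_proj_eq[rotated])
    then show ?thesis by (simp add: add.assoc)
  qed
  obtain D where D: "has_log_deriv (H 2) D"
    using has_log_deriv_exists detH by blast
  have tele: "has_log_deriv (H (2 * int j + 2)) (D + (\<Sum>i = 1..int j. projection (q (2 * i)) (q (2 * i + 1))))" for j
  proof (induction j)
    case (Suc j)
    have "{1..int (Suc j)} = insert (int j + 1) {1..int j}" by auto
    moreover have "has_log_deriv (H (2 * (int j + 1))) (D + (\<Sum>i = 1..int j. projection (q (2 * i)) (q (2 * i + 1))))"
      using Suc by (simp add: algebra_simps)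
    from double_step[OF this] have "has_log_deriv (H (2 * int (Suc j) + 2))
        (D + (\<Sum>i = 1..int j. projection (q (2 * i)) (q (2 * i + 1))) +
          projection (q (2 * (int j + 1))) (q (2 * (int j + 1) + 1)))"
      by (simp add: algebra_simps)
    ultimately show ?case by (simp add: add.assoc add.commute)
  qed (use D in simp)
  have HA: "proj_eq_at_1 (A ** H k) (H (k + 2 * int n))" for k
    using twisted_frames[of V A "2 * int n", OF V inv mono, of k "k + 1" "k - 1"] by (simp add: H_def algebra_simps)
  \<comment> \<open>At \<open>t = 1\<close> the matrix \<open>A\<close> takes the frame at \<open>0\<close> to the one at \<open>2n\<close>, the same up to a scalar.\<close>
  obtain d where A1: "poly_mat_at 1 A = mat d" and d: "d \<noteq> 0"
  proof -
    obtain f g where fg: "poly f 1 \<noteq> 0" "mscale f (A ** H 0) = mscale g (H (2 * int n))"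
      using HA[of 0] unfolding proj_eq_at_1_def by auto
    have F: "F (2 * int n) = F 0"
      using per[of 0] per[of 1] per[of "-1"] by (simp add: F_def add.commute)
    have H0: "F 0 = mscale (1 / (c 0 * c 1 * c (-1))) (poly_mat_at 1 (H 0))"
      using c by (simp add: H1 mscale_mscale) (simp add: vec_eq_iff)
    have "mscale (poly f 1) (poly_mat_at 1 A ** poly_mat_at 1 (H 0)) =
        mscale (poly g 1) (poly_mat_at 1 (H (2 * int n)))"
      using arg_cong[OF fg(2), of "poly_mat_at 1"] by (simp add: poly_mat_at_mscale poly_mat_at_mult)
    then obtain e where "mscale (poly f 1) (poly_mat_at 1 A ** poly_mat_at 1 (H 0)) = mscale e (poly_mat_at 1 (H 0))"
      unfolding H1[of "2 * int n"] F unfolding H0 mscale_mscale by blast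
    then have "mscale (1 / poly f 1) (mscale (poly f 1) (poly_mat_at 1 A ** poly_mat_at 1 (H 0))) =
        mscale (1 / poly f 1) (mscale e (poly_mat_at 1 (H 0)))" by simp
    then have "poly_mat_at 1 A ** poly_mat_at 1 (H 0) = mat (e / poly f 1) ** poly_mat_at 1 (H 0)"
      using fg(1) by (simp add: mat_mult_eq_mscale mscale_mscale) (simp add: vec_eq_iff)
    moreover obtain B where "poly_mat_at 1 (H 0) ** B = mat 1"
      using detH[of 0] unfolding invertible_det_nz[symmetric] invertible_def by blast
    ultimately have A1: "poly_mat_at 1 A = mat (e / poly f 1)"
      by (metis matrix_mul_assoc matrix_mul_rid)
    moreover have "e / poly f 1 \<noteq> 0"
      using inv unfolding A1 by (auto simp: invertible_det_nz det_2 mat_def)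
    ultimately show ?thesis by (rule that)
  qed
  have "has_log_deriv (A ** H 2) (D + mscale (1 / d) (mat_deriv A))"
    using A1 d D by (rule has_log_deriv_scalar_mult)
  then have "has_log_deriv (H (2 * int n + 2)) (D + mscale (1 / d) (mat_deriv A))"
    using has_log_deriv_proj_eq[OF HA[of 2]] by (simp add: add.commute)
  from has_log_deriv_unique[OF detH this tele]
  have "pgl2 (mscale (1 / d) (mat_deriv A)) = pgl2 (\<Sum>i = 1..int n. projection (q (2 * i)) (q (2 * i + 1)))"
    by (auto simp: pgl2_eq_iff add.assoc)
  moreover have "map_matrix (\<lambda>f. poly (pderiv f) 1 / poly_mat_at 1 A $ 1 $ 1) A = mscale (1 / d) (mat_deriv A)"
    by (simp add: A1 vec_eq_iff) (simp add: mat_def poly_mat_at_def)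
  ultimately show ?thesis by (simp add: infinitesimal_monodromy_def)
qed

text \<open>
The projection takes \<open>v = (X, Y)\<close> to \<open>(X - b Y) / (a - b)\<close> times \<open>(a, 1)\<close>, and the bracket of \<open>v\<close> with
\<open>(a, 1)\<close> is \<open>X - a Y\<close>. This is where the two linear factors of each summand of \<open>\<chi>\<^sub>P\<close> come from.
\<close>

lemma bracket_sum_projections:
  "bracket v ((\<Sum>i\<in>I. projection (a i) (b i)) *v v) =
    (\<Sum>i\<in>I. (v $ 1 - a i * v $ 2) * (v $ 1 - b i * v $ 2) / (a i - b i))"
proof -
  have 0: "bracket v 0 = 0"
    by (simp add: bracket_def)
  have plus: "bracket v ((M + N) *v v) = bracket v (M *v v) + bracket v (N *v v)" for M N
    by (simp add: mat2_simps algebra_simps)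
  have one: "bracket v (projection a b *v v) = (v $ 1 - a * v $ 2) * (v $ 1 - b * v $ 2) / (a - b)" for a b
    by (simp add: projection_def mat2_simps diff_divide_distrib add_divide_distrib algebra_simps)
  show ?thesis
    by (induction I rule: infinite_finite_induct) (simp_all add: 0 plus one)
qed

section \<open>Existence of a lift\<close>

text \<open>
The recursion \<open>G\<^sub>k\<^sub>+\<^sub>1 = G\<^sub>k T\<^sub>k\<close> over all integers. For negative indices it has to be solved backwards,
where the adjugate of \<open>T\<^sub>k\<close> replaces the inverse so that the entries remain polynomials; the
recursion then holds up to the factor \<open>det T\<^sub>k\<close>.
\<close>

lemma matrix_sequence_exists:
  assumes T: "\<And>k. poly (det (T k)) 1 \<noteq> 0"
  shows "\<exists>G :: int \<Rightarrow> _. G 0 = B \<and> (\<forall>k. proj_eq_at_1 (G k ** T k) (G (k + 1)))"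
proof -
  define up where "up = rec_nat B (\<lambda>j X. X ** T (int j))"
  define dn where "dn = rec_nat B (\<lambda>j X. X ** adj2 (T (- int j - 1)))"
  have up: "up 0 = B" "up (Suc j) = up j ** T (int j)" for j
    by (simp_all add: up_def)
  have dn: "dn 0 = B" "dn (Suc j) = dn j ** adj2 (T (- int j - 1))" for j
    by (simp_all add: dn_def)
  define G where "G k = (if 0 \<le> k then up (nat k) else dn (nat (- k)))" for k
  have "proj_eq_at_1 (G k ** T k) (G (k + 1))" for k
  proof (cases "0 \<le> k")
    case True
    then have "G (k + 1) = G k ** T k"
      by (simp add: G_def nat_add_distrib up)
    then show ?thesis by (simp add: proj_eq_refl)
  next
    case False
    define j where "j = nat (- k - 1)"
    have k: "k = - int j - 1" using False by (simp add: j_def)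
    have "nat (- k) = Suc j" using k by simp
    then have "G k = dn j ** adj2 (T k)" using False by (simp add: G_def dn k)
    moreover have "G (k + 1) = dn j" unfolding k by (cases "j = 0") (simp_all add: G_def up dn)
    ultimately have "G k ** T k = mscale (det (T k)) (G (k + 1))"
      by (simp add: adj2_mult mat_mult_eq_mscale flip: matrix_mul_assoc)
    then show ?thesis using proj_eq_mscale[OF T] by simp
  qed
  moreover have "G 0 = B" by (simp add: G_def up)
  ultimately show ?thesis by blast
qed

text \<open>
Projective solutions of the recursion are determined by their value at \<open>0\<close>. This serves twice: to
recognise the solution at \<open>t = 1\<close> as the frames of the given polygon, and to obtain the monodromy
from the periodicity of the corner ratios.
\<close>

lemma matrix_sequence_unique:
  fixes B C T :: "int \<Rightarrow> 'a::field poly ^ 2 ^ 2"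
  assumes B: "\<And>k. proj_eq_at_1 (B k ** T k) (B (k + 1))"
    and C: "\<And>k. proj_eq_at_1 (C k ** T k) (C (k + 1))"
    and T: "\<And>k. poly (det (T k)) 1 \<noteq> 0"
    and 0: "proj_eq_at_1 (B 0) (C 0)"
  shows "proj_eq_at_1 (B k) (C k)"
proof -
  have *: "proj_eq_at_1 (B k) (C k) \<longleftrightarrow> proj_eq_at_1 (B (k + 1)) (C (k + 1))" for k
  proof
    assume "proj_eq_at_1 (B k) (C k)"
    then show "proj_eq_at_1 (B (k + 1)) (C (k + 1))"
      by (meson B C proj_eq_mult_right proj_eq_sym proj_eq_trans)
  next
    assume "proj_eq_at_1 (B (k + 1)) (C (k + 1))"
    then have "proj_eq_at_1 (B k ** T k) (C k ** T k)"
      by (meson B C proj_eq_sym proj_eq_trans)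
    then show "proj_eq_at_1 (B k) (C k)" using T by (rule proj_eq_mult_right_cancel)
  qed
  show ?thesis
  proof (induction k rule: int_induct[where k = 0])
    case (step2 i)
    then show ?case using *[of "i - 1"] by simp
  qed (use 0 * in auto)
qed

text \<open>
Matrices over \<open>F\<close> as constant families. Identities that hold only at \<open>t = 1\<close> can thereby be
stated with the same projective equality as identities between families.
\<close>

definition const_mat :: "'a::field ^ 2 ^ 2 \<Rightarrow> 'a poly ^ 2 ^ 2" where
  "const_mat A = map_matrix (\<lambda>a. [:a:]) A"

lemma poly_mat_at_const_mat: "poly_mat_at t (const_mat A) = A"
  by (simp add: const_mat_def poly_mat_at_def vec_eq_iff)

lemma const_mat_mult: "const_mat (A ** B) = const_mat A ** const_mat B"
  by (simp add: const_mat_def mat2_simps)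

lemma const_mat_mscale: "const_mat (mscale c A) = mscale [:c:] (const_mat A)"
  by (simp add: const_mat_def vec_eq_iff)

lemma proj_eq_const_mat:
  assumes "mscale a A = mscale b B" "a \<noteq> 0" "b \<noteq> 0"
  shows "proj_eq_at_1 (const_mat A) (const_mat B)"
  using arg_cong[OF assms(1), of const_mat] assms(2,3)
  by (intro proj_eqI[of "[:a:]" _ "[:b:]"]) (simp_all add: const_mat_mscale)

lemma proj_eq_evaluate:
  assumes "proj_eq_at_1 B C"
  shows "proj_eq_at_1 (const_mat (poly_mat_at 1 B)) (const_mat (poly_mat_at 1 C))"
proof -
  obtain f g where "poly f 1 \<noteq> 0" "poly g 1 \<noteq> 0" "mscale f B = mscale g C"
    using assms unfolding proj_eq_at_1_def by blast
  then show ?thesis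
    by (intro proj_eq_const_mat[of "poly f 1" _ "poly g 1"]) (simp_all flip: poly_mat_at_mscale)
qed

lemma generic_point_proj_eq:
  assumes BC: "proj_eq_at_1 B C" and B: "det (poly_mat_at 1 B) \<noteq> 0" and u: "poly_vec_at 1 u \<noteq> 0"
  shows "generic_point (B *v u) = generic_point (C *v u)"
proof -
  obtain f g where fg: "poly f 1 \<noteq> 0" "poly g 1 \<noteq> 0" "f *s (B *v u) = g *s (C *v u)"
    using proj_eq_mult_vec[OF BC] by blast
  have b: "poly_vec_at 1 (B *v u) \<noteq> 0"
    using B u by (simp add: poly_mat_at_mult_vec mult_vec_nonzero)
  have "poly f 1 *s poly_vec_at 1 (B *v u) = poly g 1 *s poly_vec_at 1 (C *v u)"
    using arg_cong[OF fg(3), of "poly_vec_at 1"] by (simp add: poly_vec_at_scale)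
  then have c: "poly_vec_at 1 (C *v u) \<noteq> 0" using b fg by (metis vector_mul_eq_0)
  show ?thesis unfolding generic_point_eq_iff_scale[OF b c] using fg by blast
qed

text \<open>
Converse of the moving frame equation. In the coordinates given by \<open>G\<^sub>k\<close>, the four vertices
\<open>p\<^sub>k\<close>, \<open>p\<^sub>k\<^sub>+\<^sub>1\<close>, \<open>p\<^sub>k\<^sub>-\<^sub>1\<close>, \<open>p\<^sub>k\<^sub>+\<^sub>2\<close> are \<open>(1,0)\<close>, \<open>(0,1)\<close>, \<open>(1,1)\<close>, \<open>(y\<^sub>k,1)\<close>, whose cross ratio is \<open>y\<^sub>k\<close>.
\<close>

lemma corner_ratio_frames:
  fixes G :: "int \<Rightarrow> 'a::field poly ^ 2 ^ 2" and y :: "int \<Rightarrow> 'a poly"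
  assumes G: "\<And>k. det (poly_mat_at 1 (G k)) \<noteq> 0"
    and step: "\<And>k. proj_eq_at_1 (G k ** step_matrix (y k)) (G (k + 1))"
    and y: "\<And>k. poly (y k) 1 \<noteq> 0"
  shows "corner_ratio (\<lambda>k. generic_point (G k *v vector [1, 0])) k = to_fract (y k)"
proof -
  let ?e = "vector [1, 0] :: 'a poly ^ 2" and ?T = "\<lambda>k. step_matrix (y k)"
  have dT: "det (poly_mat_at 1 (?T k)) \<noteq> 0" for k
    using y by (simp add: poly_mat_at_step det_step)
  have e: "poly_vec_at 1 ?e \<noteq> 0" by (simp add: poly_vec_at_def vec_eq_iff forall_2)
  have next1: "generic_point (G (k + 1) *v ?e) = generic_point (G k *v vector [0, - 1])"
  proof -
    have "generic_point (G k ** ?T k *v ?e) = generic_point (G (k + 1) *v ?e)"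
      using step G dT e by (intro generic_point_proj_eq) (auto simp: poly_mat_at_mult det_mul)
    moreover have "?T k *v ?e = vector [0, - 1]"
      by (simp add: step_matrix_def mat2_simps)
    ultimately show ?thesis by (metis matrix_vector_mul_assoc)
  qed
  have next2: "generic_point (G (k + 2) *v ?e) = generic_point (G k *v vector [- y k, - 1])"
  proof -
    have "proj_eq_at_1 (G k ** ?T k ** ?T (k + 1)) (G (k + 1) ** ?T (k + 1))"
      using step by (rule proj_eq_mult_right)
    also have "proj_eq_at_1 \<dots> (G (k + 2))" using step[of "k + 1"] by (simp add: add.assoc)
    finally have "generic_point (G k ** ?T k ** ?T (k + 1) *v ?e) = generic_point (G (k + 2) *v ?e)"
      using G dT e by (intro generic_point_proj_eq) (auto simp: poly_mat_at_mult det_mul)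
    moreover have "?T k *v (?T (k + 1) *v ?e) = vector [- y k, - 1]"
      by (simp add: step_matrix_def mat2_simps)
    ultimately show ?thesis by (metis matrix_vector_mul_assoc)
  qed
  have prev: "generic_point (G (k - 1) *v ?e) = generic_point (G k *v vector [1, 1])"
  proof -
    have 1: "G (k - 1) ** ?T (k - 1) *v vector [1, 1] = y (k - 1) *s (G (k - 1) *v ?e)"
      by (simp add: step_matrix_def mat2_simps)
    have nz: "poly_vec_at 1 (G (k - 1) *v ?e) \<noteq> 0"
      using G e by (simp add: poly_mat_at_mult_vec mult_vec_nonzero)
    have nz': "poly_vec_at 1 (y (k - 1) *s (G (k - 1) *v ?e)) \<noteq> 0"
      unfolding poly_vec_at_scale using nz y by simp
    have "proj_eq_at_1 (G (k - 1) ** ?T (k - 1)) (G k)"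
      using step[of "k - 1"] by simp
    then have "generic_point (G (k - 1) ** ?T (k - 1) *v vector [1, 1]) = generic_point (G k *v vector [1, 1])"
      using G dT
      by (intro generic_point_proj_eq)
        (auto simp: poly_mat_at_mult det_mul poly_vec_at_def vec_eq_iff forall_2)
    moreover have "generic_point (y (k - 1) *s (G (k - 1) *v ?e)) = generic_point (G (k - 1) *v ?e)"
      unfolding generic_point_eq_iff_scale[OF nz' nz]
      by (rule exI[of _ 1], rule exI[of _ "y (k - 1)"]) (simp add: y)
    ultimately show ?thesis unfolding 1 by simp
  qed
  have "poly (det (G k)) 1 \<noteq> 0" using G by (simp add: poly_det)
  then have "det (G k) \<noteq> 0" by auto
  then show ?thesis
    unfolding corner_ratio_def next1 next2 prev
    by (subst cross_ratio_generic_point_iff; unfold bracket_mult)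
      (simp_all add: bracket_def)
qed

text \<open>
The recursion is started with the constant frame of the given polygon. At \<open>t = 1\<close> its
solution then consists of the frames of that polygon, which gives the initial condition \<open>P\<^sub>1 = P\<close>
and, since distinctness at \<open>t = 1\<close> implies distinctness over \<open>F(t)\<close>, also the nondegeneracy
of the family.
\<close>

lemma lift_exists:
  fixes q :: "int \<Rightarrow> 'a::field" and n :: nat
  defines "x \<equiv> corner_ratio (\<lambda>k. affine_point (q k))"
  assumes n: "0 < n"
    and dist: "\<And>k. q k \<noteq> q (k + 1)" "\<And>k. q k \<noteq> q (k + 2)"
    and per: "\<And>k. q (k + 2 * int n) = q k"
  shows "\<exists>V A. (\<forall>k. poly_vec_at 1 (V k) \<noteq> 0) \<and> invertible (poly_mat_at 1 A) \<and>
    twisted_polygon (2 * n) (\<lambda>k. generic_point (V k)) (generic_PGL2 A) \<and>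
    (\<forall>k. point (poly_vec_at 1 (V k)) = affine_point (q k)) \<and>
    (\<forall>k. corner_ratio (\<lambda>k. generic_point (V k)) k = to_fract (deformed_ratio x k))"
proof -
  define F where "F k = frame (affine_vec (q k)) (affine_vec (q (k + 1))) (affine_vec (q (k - 1)))" for k
  define T where "T k = step_matrix (deformed_ratio x k)" for k
  have dist': "q k \<noteq> q (k - 1)" "q (k + 1) \<noteq> q (k - 1)" for k
    using dist(1)[of "k - 1"] dist(2)[of "k - 1"] by (simp_all add: eq_commute add.commute)
  have x: "x k = (q k - q (k - 1)) / (q k - q (k + 2)) * ((q (k + 1) - q (k + 2)) / (q (k + 1) - q (k - 1)))" for k
    by (simp add: x_def corner_ratio_def affine_point_def cross_ratio_point affine_vec_nonzero bracket_affine_vec)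
  have x_nz: "x k \<noteq> 0" for k
  proof -
    have "q (k + 1) \<noteq> q (k + 2)" using dist(1)[of "k + 1"] by (simp add: add.assoc)
    then show ?thesis using dist dist' by (simp add: x)
  qed
  have y1: "poly (deformed_ratio x k) 1 = x k" for k by (simp add: deformed_ratio_def)
  have T: "poly (det (T k)) 1 \<noteq> 0" for k
    by (simp add: T_def det_step y1 x_nz)
  have F_step: "mscale (q k - q (k + 2)) (F k ** step_matrix (x k)) = mscale (- (q k - q (k - 1))) (F (k + 1))" for k
  proof -
    have "(q k - q (k - 1)) * (q (k + 1) - q (k + 2)) = x k * ((q k - q (k + 2)) * (q (k + 1) - q (k - 1)))"
    proof -
      have "a * c = a / b * (c / d) * (b * d)" if "b \<noteq> 0" "d \<noteq> 0" for a b c d :: 'a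
        using that by simp
      then show ?thesis unfolding x using dist(2)[of k] dist'(2)[of k] by auto
    qed
    then show ?thesis
      using frame_step[of "affine_vec (q k)" "affine_vec (q (k - 1))" "affine_vec (q (k + 1))"
        "affine_vec (q (k + 2))" "x k"] by (simp add: F_def bracket_affine_vec add.commute)
  qed
  have detF: "det (F k) \<noteq> 0" for k
    using dist(1)[of k] dist'[of k] by (auto simp: F_def det_frame bracket_affine_vec)
  obtain G where G0: "G 0 = const_mat (F 0)" and G: "\<And>k. proj_eq_at_1 (G k ** T k) (G (k + 1))"
    using matrix_sequence_exists[of T "const_mat (F 0)", OF T] by blast
  \<comment> \<open>At \<open>t = 1\<close> the deformed ratios are the original ones, so \<open>G\<close> and \<open>F\<close> solve the same recursion.\<close>
  have G1: "\<exists>m. m \<noteq> 0 \<and> poly_mat_at 1 (G k) = mscale m (F k)" for k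
  proof -
    have "proj_eq_at_1 (const_mat (poly_mat_at 1 (G k))) (const_mat (F k))"
    proof (rule matrix_sequence_unique[where T = "\<lambda>k. const_mat (step_matrix (x k))"])
      show "proj_eq_at_1 (const_mat (poly_mat_at 1 (G k)) ** const_mat (step_matrix (x k)))
          (const_mat (poly_mat_at 1 (G (k + 1))))" for k
        using proj_eq_evaluate[OF G[of k]]
        by (simp add: poly_mat_at_mult const_mat_mult T_def poly_mat_at_step y1)
      show "proj_eq_at_1 (const_mat (F k) ** const_mat (step_matrix (x k))) (const_mat (F (k + 1)))" for k
        using F_step[of k] dist(2)[of k] dist'(1)[of k]
        by (subst const_mat_mult[symmetric], intro proj_eq_const_mat) auto
      show "poly (det (const_mat (step_matrix (x k)))) 1 \<noteq> 0" for k
        by (simp add: poly_det poly_mat_at_const_mat det_step x_nz)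
      show "proj_eq_at_1 (const_mat (poly_mat_at 1 (G 0))) (const_mat (F 0))"
        by (simp add: G0 poly_mat_at_const_mat proj_eq_refl)
    qed
    then obtain f g where fg: "poly f 1 \<noteq> 0" "poly g 1 \<noteq> 0"
      and "mscale f (const_mat (poly_mat_at 1 (G k))) = mscale g (const_mat (F k))"
      unfolding proj_eq_at_1_def by blast
    then have "mscale (poly f 1) (poly_mat_at 1 (G k)) = mscale (poly g 1) (F k)"
      by (metis poly_mat_at_const_mat poly_mat_at_mscale)
    then have "poly_mat_at 1 (G k) = mscale (poly g 1 / poly f 1) (F k)"
      using fg by (simp add: vec_eq_iff field_simps)
    then show ?thesis using fg by (intro exI[of _ "poly g 1 / poly f 1"]) simp
  qed
  then have detG: "det (poly_mat_at 1 (G k)) \<noteq> 0" for k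
    using detF by (metis det_mscale mult_eq_0_iff power_not_zero)
  define V where "V k = G k *v vector [1, 0]" for k
  have V1: "\<exists>c. c \<noteq> 0 \<and> poly_vec_at 1 (V k) = c *s affine_vec (q k)" for k
  proof -
    obtain m where m: "m \<noteq> 0" "poly_mat_at 1 (G k) = mscale m (F k)" using G1 by blast
    have e: "poly_vec_at 1 (vector [1, 0] :: 'a poly ^ 2) = vector [1, 0]"
      by (simp add: poly_vec_at_def vec_eq_iff forall_2)
    have "poly_vec_at 1 (V k) = (m * (q (k - 1) - q (k + 1))) *s affine_vec (q k)"
      unfolding V_def poly_mat_at_mult_vec m e
      by (simp add: F_def frame_def mat2_simps)
    then show ?thesis using m dist'(2)[of k] by (metis eq_iff_diff_eq_0 mult_eq_0_iff)
  qed
  have V_nz: "poly_vec_at 1 (V k) \<noteq> 0" for k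
    using V1[of k] affine_vec_nonzero[of "q k"] by (metis vector_mul_eq_0)
  have V_point: "point (poly_vec_at 1 (V k)) = affine_point (q k)" for k
    using V1[of k] V_nz[of k] affine_vec_nonzero[of "q k"]
    by (auto simp: affine_point_def point_eq_iff bracket_scale bracket_self)
  have V_dist: "generic_point (V k) \<noteq> generic_point (V l)" if "q k \<noteq> q l" for k l
  proof -
    obtain c d where "c \<noteq> 0" "d \<noteq> 0"
      "poly_vec_at 1 (V k) = c *s affine_vec (q k)" "poly_vec_at 1 (V l) = d *s affine_vec (q l)"
      using V1 by metis
    then have "poly (bracket (V k) (V l)) 1 \<noteq> 0"
      using that by (simp add: poly_bracket bracket_scale bracket_affine_vec)
    then have "bracket (V k) (V l) \<noteq> 0" by auto
    then show ?thesis
      using V_nz[THEN poly_vec_at_nonzeroD] by (simp add: generic_point_eq_iff_bracket)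
  qed
  \<comment> \<open>The adjugate stands for the inverse: projectively, \<open>A\<close> takes the frame at \<open>0\<close> to the one at \<open>2n\<close>.\<close>
  define A where "A = G (2 * int n) ** adj2 (G 0)"
  have "det (adj2 B) = det B" for B :: "'a ^ 2 ^ 2"
    by (simp add: det_2 adj2_def mult.commute)
  then have "det (poly_mat_at 1 A) \<noteq> 0"
    using detG by (simp add: A_def poly_mat_at_mult det_mul poly_mat_at_adj2)
  then have A1: "invertible (poly_mat_at 1 A)" by (simp add: invertible_det_nz)
  have x_per: "x (k + 2 * int n) = x k" for k
    using per[of k] per[of "k + 1"] per[of "k + 2"] per[of "k - 1"]
    by (simp add: x algebra_simps)
  have T_per: "T (k + 2 * int n) = T k" for k
    by (simp add: T_def deformed_ratio_def x_per)
  have "proj_eq_at_1 (A ** G k) (G (k + 2 * int n))" for k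
  proof (rule matrix_sequence_unique[where T = T and B = "\<lambda>k. A ** G k" and C = "\<lambda>k. G (k + 2 * int n)"])
    show "proj_eq_at_1 (A ** G k ** T k) (A ** G (k + 1))" for k
      using proj_eq_mult_left[OF G[of k]] by (simp add: matrix_mul_assoc)
    show "proj_eq_at_1 (G (k + 2 * int n) ** T k) (G (k + 1 + 2 * int n))" for k
      using G[of "k + 2 * int n"] unfolding T_per by (simp add: algebra_simps)
    have "A ** G 0 = mscale (det (G 0)) (G (2 * int n))"
      by (simp add: A_def adj2_mult mat_mult_eq_mscale flip: matrix_mul_assoc)
    moreover have "poly (det (G 0)) 1 \<noteq> 0" using detG by (simp add: poly_det)
    ultimately show "proj_eq_at_1 (A ** G 0) (G (0 + 2 * int n))"
      using proj_eq_mscale by simp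
  qed (rule T)
  then have "generic_point (A *v V k) = generic_point (V (k + 2 * int n))" for k
    unfolding V_def matrix_vector_mul_assoc using \<open>det (poly_mat_at 1 A) \<noteq> 0\<close> detG
    by (intro generic_point_proj_eq)
      (auto simp: poly_mat_at_mult det_mul poly_vec_at_def vec_eq_iff forall_2)
  then have "generic_point (V (k + int (2 * n))) = PGL2_act (generic_PGL2 A) (generic_point (V k))" for k
    using A1 poly_vec_at_nonzeroD[OF V_nz] by (simp add: PGL2_act_generic_point)
  moreover have "q (k + 1) \<noteq> q (k + 2)" for k using dist(1)[of "k + 1"] by (simp add: add.assoc)
  ultimately have "twisted_polygon (2 * n) (\<lambda>k. generic_point (V k)) (generic_PGL2 A)"
    using n dist V_dist by (simp add: twisted_polygon_def)
  moreover have "corner_ratio (\<lambda>k. generic_point (V k)) k = to_fract (deformed_ratio x k)" for k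
    unfolding V_def using corner_ratio_frames[of G "deformed_ratio x", OF detG] G
    by (simp add: T_def y1 x_nz)
  ultimately show ?thesis using V_nz V_point A1 by blast
qed

theorem proposition5p2:
  fixes n :: nat and sm s :: "int \<Rightarrow> 'a::field"
  assumes "closed_polygon n (\<lambda>i. affine_point (sm i))"
    and "closed_polygon n (\<lambda>i. affine_point (s i))"
    and "closed_polygon (2 * n) (intertwine (\<lambda>i. affine_point (sm i)) (\<lambda>i. affine_point (s i)))"
  shows
    "(\<exists>vm v A. deformation_lift n (\<lambda>i. affine_point (sm i)) (\<lambda>i. affine_point (s i)) vm v A) \<and>
     (\<forall>vm v A. deformation_lift n (\<lambda>i. affine_point (sm i)) (\<lambda>i. affine_point (s i)) vm v A \<longrightarrow>
        infinitesimal_monodromy A =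
          pgl2 (\<Sum>i = 1..int n. map_matrix ((*) (1 / (sm i - s i)))
                  (vector [vector [sm i, - sm i * s i], vector [1, - s i]])) \<and>
        (\<forall>X Y. pgl2_eigenvector (infinitesimal_monodromy A) (vector [X, Y]) \<longleftrightarrow>
           (X, Y) \<noteq> (0, 0) \<and> chi n sm s X Y = 0))"
proof -
  define q where "q = intertwine sm s"
  have aff: "intertwine (\<lambda>i. affine_point (sm i)) (\<lambda>i. affine_point (s i)) = (\<lambda>k. affine_point (q k))"
    unfolding q_def by (rule intertwine_map)
  have n: "0 < n" and per: "\<And>k. q (k + 2 * int n) = q k"
    and dist: "\<And>k. q k \<noteq> q (k + 1)" "\<And>k. q k \<noteq> q (k + 2)"
    using assms(3) unfolding aff closed_polygon_def twisted_polygon_def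
    by (simp_all add: affine_point_eq_iff)
      (simp_all add: affine_point_def PGL2_act_id_point affine_vec_nonzero,
       simp_all add: affine_point_eq_iff flip: affine_point_def)
  let ?lift = "deformation_lift n (\<lambda>i. affine_point (sm i)) (\<lambda>i. affine_point (s i))"
  obtain V A where VA: "(\<forall>k. poly_vec_at 1 (V k) \<noteq> 0) \<and> invertible (poly_mat_at 1 A) \<and>
    twisted_polygon (2 * n) (\<lambda>k. generic_point (V k)) (generic_PGL2 A) \<and>
    (\<forall>k. point (poly_vec_at 1 (V k)) = affine_point (q k)) \<and>
    (\<forall>k. corner_ratio (\<lambda>k. generic_point (V k)) k =
      to_fract (deformed_ratio (corner_ratio (\<lambda>k. affine_point (q k))) k))"
    using lift_exists[of n q, OF n dist per] by blast
  have V: "intertwine (\<lambda>i. V (2 * i)) (\<lambda>i. V (2 * i + 1)) = V"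
    by (rule ext) (simp add: intertwine_def)
  have "?lift (\<lambda>i. V (2 * i)) (\<lambda>i. V (2 * i + 1)) A"
    unfolding deformation_lift_iff V aff using VA by blast
  moreover have "infinitesimal_monodromy A = pgl2 (\<Sum>i = 1..int n. projection (sm i) (s i))"
    if lift: "?lift vm v A" for vm v A
  proof -
    let ?V = "intertwine vm v"
    have "infinitesimal_monodromy A = pgl2 (\<Sum>i = 1..int n. projection (q (2 * i)) (q (2 * i + 1)))"
      using lift unfolding deformation_lift_iff aff twisted_polygon_def
      by (intro infinitesimal_monodromy_of_lift[where V = ?V
            and x = "corner_ratio (\<lambda>k. affine_point (q k))"]) (auto simp: per dist)
    then show ?thesis by (simp add: q_def)
  qed
  moreover have "pgl2_eigenvector (pgl2 (\<Sum>i = 1..int n. projection (sm i) (s i))) (vector [X, Y]) \<longleftrightarrow>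
      (X, Y) \<noteq> (0, 0) \<and> chi n sm s X Y = 0" for X Y
    by (simp add: pgl2_eigenvector_iff bracket_sum_projections chi_def vec_eq_iff forall_2)
  ultimately show ?thesis
    unfolding projection_def by (intro conjI allI impI) (blast, simp_all)
qed

end
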